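(* For each $n$ consider a $GI/M/1/n$ queueing system whose interarrival distribution function $A=A_n$ and service rate $\mu=\mu_n$ may depend on $n$, and let $p_n$ be the loss probability of the $n$-th system (the one with buffer size $n$). Suppose the load of the $n$-th system is $\rho=\rho(n)=1-\epsilon$, where $\epsilon=\epsilon_n>0$, and that as $n\to\infty$ we have $\epsilon\to0$ and $\epsilon n\to 0$. Assume that $\rho_3=\rho_3(n)$ is a bounded function of $n$ and that the limit $\widetilde\rho_2=\lim_{n\to\infty}\rho_2(n)$ exists. Then, as $n\to\infty$, $$p_n=\frac{\widetilde\rho_2}{2n}+o\Big(\frac1n\Big).$$
   Context: $GI/M/1/n$ queue: a single-server loss system in which interarrival times are i.i.d. nonnegative random variables with distribution function $A(x)$ having mean $1/\lambda$, $0<\lambda<\infty$; service times are i.i.d. exponential with parameter $\mu>0$, independent of arrivals; the system holds at most $n$ customers (the buffer size $n$ includes the position at the server), and customers arriving when the system is full are lost. Notation: $\alpha(s)=\int_0^\infty e^{-sx}\,dA(x)$; $\rho=\lambda/\mu$; $\rho_m=\mu^m\int_0^\infty x^m\,dA(x)$ for $m=1,2,\dots$ (so $\rho_1=\rho^{-1}$). When $A=A_n$ and $\mu=\mu_n$ depend on $n$, all these quantities depend on $n$, and $\rho_m(n)$ denotes $\rho_m$ computed for the $n$-th system. The loss probability $p_n$ is the stationary probability that an arriving customer finds the system (with buffer size $n$) full. It exists for every value of $\rho$ and is given by $$p_n=\frac{1}{\sum_{j=0}^n\pi_j},\qquad \sum_{j=0}^\infty\pi_jz^j=\frac{(1-z)\,\alpha(\mu-\mu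 z)}{\alpha(\mu-\mu z)-z},\quad |z|<\sigma,$$ where $\sigma$ is the minimum nonnegative solution of $z=\alpha(\mu-\mu z)$; $\sigma\in(0,1)$ if $\lambda<\mu$ and $\sigma=1$ otherwise. (Here $\alpha,\mu$, hence $\pi_j$ and $\sigma$, are those of the $n$-th system.) *)

theory Defs
  imports "HOL-Probability.Probability" "HOL-Library.Landau_Symbols"
begin

text \<open>
  The interarrival distribution is given by its law \<open>A\<close> on the real line, so that the
  distribution function is \<open>cdf A\<close> and integrals against \<open>dA(x)\<close> are integrals over \<open>A\<close>.
\<close>

locale GI_M_1 = real_distribution A for A :: "real measure" +
  fixes lam mu :: real
  assumes interarrival_nonneg: "AE x in A. 0 \<le> x"
    and lam_pos: "0 < lam"
    and interarrival_integrable: "integrable A (\<lambda>x. x)"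
    and interarrival_mean: "(\<integral>x. x \<partial>A) = 1 / lam"
    and mu_pos: "0 < mu"

definition rho_moment :: "real measure \<Rightarrow> real \<Rightarrow> nat \<Rightarrow> real" where
  "rho_moment A mu m = mu ^ m * (\<integral>x. x ^ m \<partial>A)"

text \<open>
  One interarrival period that starts with \<open>m\<close> customers present: its length \<open>x\<close> has law \<open>A\<close>
  and is independent of the i.i.d. exponential times \<open>s 0, \<dots>, s (m - 1)\<close>. Here \<open>s 0\<close> is the
  remaining service time of the customer at the server (again exponential, by lack of memory)
  and the others are the service times of the waiting customers. Customer number \<open>d\<close> thus
  leaves \<open>s 0 + \<dots> + s d\<close> time units after the period began.
\<close>

definition period_space :: "real measure \<Rightarrow> real \<Rightarrow> nat \<Rightarrow> (real \<times> (nat \<Rightarrow> real)) measure" where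
  "period_space A mu m =
     A \<Otimes>\<^sub>M (\<Pi>\<^sub>M k\<in>{..<m}. density lborel (\<lambda>t. ennreal (exponential_density mu t)))"

definition still_present :: "nat \<Rightarrow> real \<times> (nat \<Rightarrow> real) \<Rightarrow> nat" where
  "still_present m = (\<lambda>(x, s). card {d. d < m \<and> x < (\<Sum>k\<le>d. s k)})"

text \<open>
  The number of customers found in the \<open>GI/M/1/n\<close> system by successive arrivals is a Markov
  chain on \<open>{..n}\<close>. An arrival that finds \<open>i\<close> customers leaves \<open>min (i + 1) n\<close> customers in the
  system, since it is lost if \<open>i = n\<close>.
\<close>

definition transition_prob :: "real measure \<Rightarrow> real \<Rightarrow> nat \<Rightarrow> nat \<Rightarrow> nat \<Rightarrow> real" where
  "transition_prob A mu n i j =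
     (let m = min (i + 1) n; Q = period_space A mu m
      in measure Q {w \<in> space Q. still_present m w = j})"

definition stationary_dist :: "real measure \<Rightarrow> real \<Rightarrow> nat \<Rightarrow> (nat \<Rightarrow> real) \<Rightarrow> bool" where
  "stationary_dist A mu n q \<longleftrightarrow>
     (\<forall>j\<le>n. 0 \<le> q j) \<and> (\<Sum>j\<le>n. q j) = 1 \<and>
     (\<forall>j\<le>n. q j = (\<Sum>i\<le>n. q i * transition_prob A mu n i j))"

definition loss_prob :: "real measure \<Rightarrow> real \<Rightarrow> nat \<Rightarrow> real" where
  "loss_prob A mu n = (THE p. \<exists>q. stationary_dist A mu n q \<and> p = q n)"

end

theory Submission
  imports Defs "HOL-Computational_Algebra.Formal_Power_Series"
begin

text \<open>
  Let \<open>a\<^sub>k\<close> be the probability of \<open>k\<close> service completions in one interarrival period, \<open>c\<close> the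
  sequence of tails of \<open>a\<close>, and \<open>d\<close> the sequence of tails of \<open>c\<close>. Their sums are \<open>\<rho>\<^sub>1\<close> for \<open>c\<close> and
  \<open>\<rho>\<^sub>2 / 2\<close> for \<open>d\<close>, and the partial sums of \<open>d\<close> miss their limit by at most \<open>\<rho>\<^sub>3 / (6 (n + 1))\<close>. Read from
  the full state downwards, the stationary distribution is proportional to the sequence \<open>w\<close> with
  generating function \<open>a / (1 - c)\<close>, so that the loss probability is \<open>1 / R\<^sub>n\<close> with \<open>R\<^sub>n\<close> the partial
  sums of \<open>w\<close>. Dividing \<open>w (1 - c) = a\<close> twice by \<open>1 - z\<close> gives the convolution identity
  \<open>(R * d)\<^sub>n = (\<rho>\<^sub>1 - 1) \<Sum>\<^sub>m R\<^sub>m + n + O(1)\<close>. Since \<open>R\<close> is increasing, its left side is at most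
  \<open>R\<^sub>n \<rho>\<^sub>2 / 2\<close>; since \<open>(\<rho>\<^sub>1 - 1) n\<close> tends to \<open>0\<close>, the increments \<open>w\<close> of \<open>R\<close> stay bounded up to index
  \<open>n\<close>, and the left side is at least \<open>R\<^sub>n \<rho>\<^sub>2 / 2 - O(1)\<close>. Hence \<open>n / R\<^sub>n\<close> tends to half the
  limit of \<open>\<rho>\<^sub>2\<close>.
\<close>

section \<open>Poisson weights and their iterated tails\<close>

text \<open>Summed over all \<open>k\<close>, level \<open>r\<close> gives
  \<open>y ^ r / fact r\<close>, so each level is the sequence of tails of the level below it.
  Subtracting a finite partial sum from the known total avoids infinite series.\<close>

fun poisson_tail :: "nat \<Rightarrow> nat \<Rightarrow> real \<Rightarrow> real" where
  "poisson_tail 0 k y = y ^ k * exp (- y) / fact k"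
| "poisson_tail (Suc r) k y = y ^ r / fact r - (\<Sum>m\<le>k. poisson_tail r m y)"

lemma power_fact_deriv:
  "((\<lambda>y. y ^ Suc k / fact (Suc k)) has_real_derivative y ^ k / fact k) (at (y::real))"
proof -
  have "((\<lambda>y. y ^ Suc k / fact (Suc k)) has_real_derivative
      (real (Suc k) * y ^ k) / fact (Suc k)) (at y)"
    using DERIV_pow[of "Suc k" y] by (intro DERIV_cdivide) (simp only: diff_Suc_1')
  also have "(real (Suc k) * y ^ k) / fact (Suc k) = y ^ k / fact k"
    unfolding fact_Suc by (rule mult_divide_mult_cancel_left) simp
  finally show ?thesis .
qed

lemma poisson_weight_deriv:
  "(poisson_tail 0 (Suc k) has_real_derivative poisson_tail 0 k y - poisson_tail 0 (Suc k) y) (at y)"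
proof -
  have "((\<lambda>y. exp (- y)) has_real_derivative - exp (- y)) (at y)"
    by (auto intro!: derivative_eq_intros)
  from DERIV_mult[OF power_fact_deriv[of k y] this]
  have "((\<lambda>y. y ^ Suc k / fact (Suc k) * exp (- y)) has_real_derivative
      y ^ k / fact k * exp (- y) - y ^ Suc k / fact (Suc k) * exp (- y)) (at y)"
    by (simp add: algebra_simps del: power_Suc fact_Suc)
  then show ?thesis unfolding poisson_tail.simps(1)[abs_def] times_divide_eq_left .
qed

lemma poisson_weight_deriv_sum:
  "((\<lambda>y. 1 - (\<Sum>m\<le>k. poisson_tail 0 m y)) has_real_derivative poisson_tail 0 k y) (at y)"
proof (induction k)
  case 0
  then show ?case by (auto intro!: derivative_eq_intros)
next
  case (Suc k)
  have "((\<lambda>y. 1 - (\<Sum>m\<le>k. poisson_tail 0 m y) - poisson_tail 0 (Suc k) y)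
    has_real_derivative poisson_tail 0 k y - (poisson_tail 0 k y - poisson_tail 0 (Suc k) y)) (at y)"
    by (rule DERIV_diff[OF Suc.IH poisson_weight_deriv])
  then show ?case by (simp add: diff_diff_eq del: poisson_tail.simps)
qed

text \<open>Differentiation lowers the level by one. With the value \<open>0\<close> at the origin,
  each level is an antiderivative of the one below, so nonnegativity passes upwards.\<close>

lemma poisson_tail_deriv:
  "(poisson_tail (Suc r) k has_real_derivative poisson_tail r k y) (at y)"
proof (induction r arbitrary: k)
  case 0
  then show ?case using poisson_weight_deriv_sum[of k y]
    unfolding poisson_tail.simps(2)[abs_def] power_0 fact_0 div_by_1 by simp
next
  case (Suc r)
  have "((\<lambda>y. y ^ Suc r / fact (Suc r) - (\<Sum>m\<le>k. poisson_tail (Suc r) m y))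
    has_real_derivative y ^ r / fact r - (\<Sum>m\<le>k. poisson_tail r m y)) (at y)"
    by (intro DERIV_diff DERIV_sum power_fact_deriv Suc)
  then show ?case unfolding poisson_tail.simps(2)[of "Suc r", abs_def] poisson_tail.simps(2)[of r k y] .
qed

lemma poisson_tail_at_0: "poisson_tail (Suc r) k 0 = 0"
proof (induction r arbitrary: k)
  case 0
  have "(\<Sum>m\<le>k. (0::real) ^ m / fact m) = (\<Sum>m\<le>k. if m = 0 then 1 else 0)"
    by (intro sum.cong) auto
  then show ?case by simp
qed auto

lemma poisson_tail_nonneg: "0 \<le> y \<Longrightarrow> 0 \<le> poisson_tail r k y"
proof (induction r arbitrary: k y)
  case (Suc r)
  have "poisson_tail (Suc r) k 0 \<le> poisson_tail (Suc r) k y"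
    by (rule DERIV_nonneg_imp_nondecreasing[OF Suc.prems]) (blast intro: poisson_tail_deriv Suc.IH)
  then show ?case by (simp only: poisson_tail_at_0)
qed simp

lemma poisson_tail_measurable [measurable]: "poisson_tail r k \<in> borel_measurable borel"
proof (induction r arbitrary: k)
  case 0
  show ?case unfolding poisson_tail.simps(1)[abs_def] by measurable
next
  case (Suc r)
  note Suc [measurable]
  show ?case unfolding poisson_tail.simps(2)[abs_def] by measurable
qed

lemma poisson_tail_le:
  assumes "0 \<le> y" shows "poisson_tail (Suc r) k y \<le> y ^ r / fact r"
  using sum_nonneg[of "{..k}" "\<lambda>m. poisson_tail r m y"] poisson_tail_nonneg[OF assms] by simp

text \<open>Nonnegativity of level 1 bounds the partial sums of the weights by 1.\<close>

lemma poisson_weight_le_1: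
  assumes "0 \<le> y" shows "poisson_tail 0 k y \<le> 1"
proof -
  have "poisson_tail 0 k y \<le> (\<Sum>m\<le>k. poisson_tail 0 m y)"
    by (intro member_le_sum poisson_tail_nonneg[OF assms]) auto
  also have "\<dots> \<le> 1"
    using poisson_tail_nonneg[OF assms, of "Suc 0" k] by simp
  finally show ?thesis .
qed

section \<open>Partial summation as division by \<open>1 - fps_X\<close>\<close>

lemma fps_partial_sums:
  fixes f :: "nat \<Rightarrow> 'a :: comm_ring_1"
  shows "(1 - fps_X) * Abs_fps (\<lambda>n. \<Sum>k\<le>n. f k) = Abs_fps f"
proof (rule fps_ext)
  fix n show "fps_nth ((1 - fps_X) * Abs_fps (\<lambda>n. \<Sum>k\<le>n. f k)) n = fps_nth (Abs_fps f) n"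
    by (cases n) (auto simp: left_diff_distrib)
qed

lemma fps_1_minus_X_cancel:
  fixes f g :: "'a :: idom fps"
  assumes "(1 - fps_X) * f = (1 - fps_X) * g"
  shows "f = g"
proof -
  have "(1 - fps_X :: 'a fps) \<noteq> 0"
    by (auto simp: fps_eq_iff intro!: exI[of _ "0::nat"])
  then show ?thesis using assms by simp
qed

section \<open>The sequence \<open>w\<close> and bounds for its partial sums
  \<open>R\<close>\<close>

text \<open>Here \<open>a\<close> stands for the law of the number of completions per interarrival
  period and \<open>r1\<close> for its mean, the inverse load. Total mass and mean enter as bounds
  on partial sums.\<close>

locale kernel_sequence =
  fixes a :: "nat \<Rightarrow> real" and r1 :: real
  assumes a_nonneg: "0 \<le> a k" and a_0_pos: "0 < a 0"
    and sum_a_le: "(\<Sum>m\<le>k. a m) \<le> 1"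
    and sum_tail_le: "(\<Sum>m\<le>k. 1 - (\<Sum>l\<le>m. a l)) \<le> r1"
    and r1_gt_1: "1 < r1"
begin

definition b :: "nat \<Rightarrow> real" where "b k = (\<Sum>m\<le>k. a m)"
definition c :: "nat \<Rightarrow> real" where "c k = 1 - b k"
definition d :: "nat \<Rightarrow> real" where "d k = r1 - (\<Sum>m\<le>k. c m)"

text \<open>By \<open>fps_c\<close> this is \<open>(1 - z) a(z) / (a(z) - z)\<close>, with
  \<open>a(z)\<close> in the role of \<open>\<alpha>(\<mu> - \<mu> z)\<close>, so its coefficients
  are the \<open>\<pi>\<^sub>j\<close> of the classical loss formula. The inverse is genuine because
  \<open>1 - c\<close> has constant term \<open>a 0 > 0\<close>.\<close>

definition scale_fps :: "real fps" where
  "scale_fps = Abs_fps a * inverse (1 - Abs_fps c)"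

definition w :: "nat \<Rightarrow> real" where "w = fps_nth scale_fps"
definition R :: "nat \<Rightarrow> real" where "R n = (\<Sum>k\<le>n. w k)"

lemma fps_c: "(1 - fps_X) * Abs_fps c = 1 - Abs_fps a"
proof (rule fps_ext)
  fix n show "fps_nth ((1 - fps_X) * Abs_fps c) n = fps_nth (1 - Abs_fps a) n"
    by (cases n) (auto simp: left_diff_distrib c_def b_def)
qed

lemma fps_d: "(1 - fps_X) * Abs_fps d = fps_const r1 - Abs_fps c"
proof (rule fps_ext)
  fix n show "fps_nth ((1 - fps_X) * Abs_fps d) n = fps_nth (fps_const r1 - Abs_fps c) n"
    by (cases n) (auto simp: left_diff_distrib d_def)
qed

lemma scale_fps_eq: "scale_fps * (1 - Abs_fps c) = Abs_fps a"
proof -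
  have "fps_nth (1 - Abs_fps c) 0 \<noteq> 0" using a_0_pos by (simp add: c_def b_def)
  then show ?thesis unfolding scale_fps_def
    by (simp add: mult.assoc inverse_mult_eq_1)
qed

lemma Abs_fps_w: "Abs_fps w = scale_fps"
  by (simp add: w_def Abs_fps_inverse fps_nth_inverse)

lemma Abs_fps_R: "(1 - fps_X) * Abs_fps R = scale_fps"
  unfolding R_def[abs_def] fps_partial_sums Abs_fps_w ..

text \<open>After multiplication by \<open>1 - z\<close>, \<open>d\<close> becomes
  \<open>r1 - c = (r1 - 1) + (1 - c)\<close>, and \<open>scale_fps\<close> turns the factor
  \<open>1 - c\<close> into \<open>a\<close>.\<close>

lemma scale_fps_conv_d:
  "scale_fps * Abs_fps d = Abs_fps (\<lambda>n. (r1 - 1) * R n + b n)"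
proof (rule fps_1_minus_X_cancel)
  have "Abs_fps (\<lambda>n. (r1 - 1) * R n + b n) = fps_const (r1 - 1) * Abs_fps R + Abs_fps b"
    by (rule fps_ext) simp
  then have "(1 - fps_X) * Abs_fps (\<lambda>n. (r1 - 1) * R n + b n)
      = fps_const (r1 - 1) * ((1 - fps_X) * Abs_fps R) + (1 - fps_X) * Abs_fps b"
    by (simp only: algebra_simps)
  also have "\<dots> = fps_const (r1 - 1) * scale_fps + Abs_fps a"
    unfolding Abs_fps_R b_def[abs_def] fps_partial_sums ..
  also have "\<dots> = fps_const (r1 - 1) * scale_fps + scale_fps * (1 - Abs_fps c)"
    by (simp only: scale_fps_eq)
  also have "\<dots> = scale_fps * (fps_const (r1 - 1) + 1 - Abs_fps c)"
    by (simp add: algebra_simps)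
  also have "fps_const (r1 - 1) + 1 = fps_const r1"
    by (rule fps_ext) simp
  also have "scale_fps * (fps_const r1 - Abs_fps c) = (1 - fps_X) * (scale_fps * Abs_fps d)"
    unfolding fps_d[symmetric] by (simp only: mult.left_commute)
  finally show "(1 - fps_X) * (scale_fps * Abs_fps d)
      = (1 - fps_X) * Abs_fps (\<lambda>n. (r1 - 1) * R n + b n)" ..
qed

lemma w_conv_d: "(\<Sum>i\<le>n. w i * d (n - i)) = (r1 - 1) * R n + b n"
  using arg_cong[OF scale_fps_conv_d, of "\<lambda>f. fps_nth f (n)"]
  by (simp add: fps_mult_nth w_def atLeast0AtMost)

text \<open>One more division by \<open>1 - z\<close>. This is the identity that both bounds on
  \<open>R n\<close> start from.\<close>

lemma R_conv_d: "(\<Sum>i\<le>n. R i * d (n - i)) = (\<Sum>m\<le>n. (r1 - 1) * R m + b m)"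
proof -
  have "Abs_fps R * Abs_fps d = Abs_fps (\<lambda>n. \<Sum>m\<le>n. (r1 - 1) * R m + b m)"
    by (rule fps_1_minus_X_cancel)
       (simp add: fps_partial_sums mult.assoc[symmetric] Abs_fps_R scale_fps_conv_d)
  from arg_cong[OF this, of "\<lambda>f. fps_nth f (n)"] show ?thesis
    by (simp add: fps_mult_nth atLeast0AtMost)
qed

lemma w_0: "w 0 = 1"
  using arg_cong[OF scale_fps_eq, of "\<lambda>f. fps_nth f (0)"] a_0_pos
  by (simp add: w_def c_def b_def)

text \<open>This compares coefficients in \<open>w(z) (a(z) - z) = (1 - z) a(z)\<close>. Read
  downwards from the full state, it is the stationarity equation of state \<open>n - i\<close>; the
  separate \<open>a i\<close> comes from the lost arrivals.\<close>

lemma w_balance: "w i = (\<Sum>l\<in>{1..Suc i}. w l * a (Suc i - l)) + a i"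
proof -
  have "scale_fps * (Abs_fps a - fps_X) = scale_fps * ((1 - fps_X) - (1 - Abs_fps a))"
    by simp
  also have "\<dots> = (1 - fps_X) * (scale_fps * (1 - Abs_fps c))"
    unfolding fps_c[symmetric] by (simp add: algebra_simps)
  finally have "scale_fps * fps_X = scale_fps * Abs_fps a - (1 - fps_X) * Abs_fps a"
    unfolding scale_fps_eq by (simp add: algebra_simps)
  from arg_cong[OF this, of "\<lambda>f. fps_nth f (Suc i)"]
  have "w i = (\<Sum>l=0..Suc i. w l * a (Suc i - l)) - a (Suc i) + a i"
    by (simp add: fps_mult_nth[of scale_fps "Abs_fps a"] w_def left_diff_distrib)
  \<comment> \<open>Since \<open>w 0 = 1\<close>, the term \<open>l = 0\<close> cancels
    \<open>- a (Suc i)\<close>.\<close>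
  also have "(\<Sum>l=0..Suc i. w l * a (Suc i - l)) = a (Suc i) + (\<Sum>l=1..Suc i. w l * a (Suc i - l))"
    by (subst sum.atLeast_Suc_atMost) (auto simp: w_0)
  finally show ?thesis by simp
qed

lemma c_nonneg: "0 \<le> c k" using sum_a_le[of k] by (simp add: c_def b_def)
lemma b_le_1: "b k \<le> 1" using sum_a_le[of k] by (simp add: b_def)
lemma d_nonneg: "0 \<le> d k" using sum_tail_le[of k] by (simp add: d_def c_def b_def)

text \<open>The equation \<open>w = a + w * c\<close> is the balance of probability flows across a level.\<close>

lemma w_nonneg: "0 \<le> w n"
proof (induction n rule: less_induct)
  case (less n)
  have "scale_fps = Abs_fps a + scale_fps * Abs_fps c"
    using scale_fps_eq by (simp add: algebra_simps)
  from arg_cong[OF this, of "\<lambda>f. fps_nth f (n)"]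
  have eq: "w n = a n + (\<Sum>i=0..n. w i * c (n - i))"
    by (simp add: fps_mult_nth w_def)
  have "(\<Sum>i=0..n. w i * c (n - i)) = (\<Sum>i=0..<n. w i * c (n - i)) + w n * c 0"
    by (simp add: sum.last_plus)
  \<comment> \<open>As \<open>c 0 = 1 - a 0\<close>, moving the term \<open>i = n\<close> to the
    left leaves the factor \<open>a 0\<close>.\<close>
  with eq have "w n * a 0 = a n + (\<Sum>i=0..<n. w i * c (n - i))"
    by (simp add: c_def b_def algebra_simps)
  also have "\<dots> \<ge> 0"
    using less a_nonneg c_nonneg by (intro add_nonneg_nonneg sum_nonneg mult_nonneg_nonneg) auto
  finally show ?case using a_0_pos by (simp add: zero_le_mult_iff)
qed

lemma R_mono: "m \<le> n \<Longrightarrow> R m \<le> R n"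
  unfolding R_def using w_nonneg by (intro sum_mono2) auto

lemma R_ge_1: "1 \<le> R n"
  using R_mono[of 0 n] by (simp add: R_def w_0)

text \<open>The tails \<open>e\<close> of \<open>d\<close> decrease and their sums are at most
  \<open>t\<close>. Hence \<open>(n + 1) * e n\<close> is at most \<open>t\<close>, and summation by
  parts bounds the first moment of \<open>d\<close>. Later \<open>s\<close> is
  \<open>\<rho>\<^sub>2 / 2\<close> and \<open>t\<close> is
  \<open>\<rho>\<^sub>3 / 6\<close>.\<close>

lemma partial_sums_d_bounds:
  assumes s: "\<And>k. (\<Sum>m\<le>k. d m) \<le> s" and t: "\<And>k. (\<Sum>m\<le>k. s - (\<Sum>l\<le>m. d l)) \<le> t"
  shows "s - t / real (Suc n) \<le> (\<Sum>m\<le>n. d m)" and "(\<Sum>k\<le>n. real k * d k) \<le> t"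
proof -
  define e where "e m = s - (\<Sum>l\<le>m. d l)" for m
  have anti: "e n \<le> e m" if "m \<le> n" for m
    unfolding e_def using that d_nonneg by (simp add: sum_mono2)
  have "real (Suc n) * e n = (\<Sum>m\<le>n. e n)" by simp
  also have "\<dots> \<le> (\<Sum>m\<le>n. e m)" using anti by (intro sum_mono) auto
  also have "\<dots> \<le> t" using t[of n] by (simp add: e_def)
  finally have "e n \<le> t / real (Suc n)" by (simp add: field_simps)
  then show "s - t / real (Suc n) \<le> (\<Sum>m\<le>n. d m)" by (simp add: e_def)
  have e0: "0 \<le> e n" for n using s by (simp add: e_def)
  \<comment> \<open>Each \<open>d k\<close> is counted once for every \<open>m < k\<close>.\<close>
  have "(\<Sum>k\<le>n. real k * d k) = (\<Sum>m<n. e m - e n)" for n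
  proof (induction n)
    case (Suc n)
    have "(\<Sum>k\<le>Suc n. real k * d k) = (\<Sum>m<n. e m - e n) + real (Suc n) * d (Suc n)"
      using Suc by simp
    also have "d (Suc n) = e n - e (Suc n)" by (simp add: e_def)
    finally show ?case by (simp add: sum_subtractf algebra_simps)
  qed simp
  also have "(\<Sum>m<n. e m - e n) \<le> (\<Sum>m<n. e m)" using e0[of n] by (intro sum_mono) auto
  also have "\<dots> \<le> (\<Sum>m\<le>n. e m)" using e0 by (intro sum_mono2) auto
  also have "\<dots> \<le> t" using t[of n] by (simp add: e_def)
  finally show "(\<Sum>k\<le>n. real k * d k) \<le> t" .
qed

text \<open>In \<open>R_conv_d\<close>, monotonicity bounds the left side by \<open>R n * s\<close>.
  On the right the multiple of \<open>r1 - 1\<close> is nonnegative, and the \<open>b m\<close> fall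
  short of 1 by at most \<open>r1\<close> in total.\<close>

lemma R_lower:
  assumes s: "\<And>k. (\<Sum>m\<le>k. d m) \<le> s"
  shows "real (Suc n) - r1 \<le> R n * s"
proof -
  have "(\<Sum>m\<le>n. b m) = real (Suc n) - (\<Sum>m\<le>n. c m)"
    by (simp add: c_def sum_subtractf)
  then have "real (Suc n) - r1 \<le> (\<Sum>m\<le>n. b m)"
    using sum_tail_le[of n] by (simp add: c_def b_def)
  also have "\<dots> \<le> (\<Sum>m\<le>n. (r1 - 1) * R m + b m)"
    using r1_gt_1 R_ge_1 by (intro sum_mono) (simp add: mult_nonneg_nonneg order_trans[OF zero_le_one])
  also have "\<dots> = (\<Sum>i\<le>n. R i * d (n - i))" by (simp add: R_conv_d)
  also have "\<dots> \<le> (\<Sum>i\<le>n. R n * d (n - i))"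
    using R_mono d_nonneg by (intro sum_mono mult_right_mono) auto
  also have "\<dots> = R n * (\<Sum>i\<le>n. d i)"
    unfolding sum_distrib_left
    by (rule sum.reindex_bij_witness[of _ "\<lambda>i. n - i" "\<lambda>i. n - i"]) auto
  also have "\<dots> \<le> R n * s" using s R_ge_1[of n] by (intro mult_left_mono) auto
  finally show ?thesis .
qed

text \<open>A bootstrap: \<open>w_conv_d\<close> bounds each increment by a small multiple of
  \<open>R n\<close> plus a constant. Summing these bounds controls \<open>R n\<close> itself, and
  this is fed back into the bound for \<open>w m\<close>.\<close>

lemma w_bounded:
  assumes K: "1 / a 0 \<le> K" and small: "K * (r1 - 1) * real (Suc n) \<le> 1 / 2" and mn: "m \<le> n"
  shows "w m \<le> 2 * K"
proof -
  have K0: "0 < K" using K a_0_pos by (intro less_le_trans[of 0 "1 / a 0" K]) auto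
  have step: "w m \<le> K * ((r1 - 1) * R n + 1)" if "m \<le> n" for m
  proof -
    \<comment> \<open>In fact \<open>d 0 = r1 - 1 + a 0\<close>; the term \<open>i = m\<close> of
      the convolution alone then controls \<open>w m\<close>.\<close>
    have "a 0 \<le> d 0" using r1_gt_1 by (simp add: d_def c_def b_def)
    then have "w m * a 0 \<le> w m * d (m - m)" using w_nonneg by (intro mult_left_mono) auto
    also have "\<dots> \<le> (\<Sum>i\<le>m. w i * d (m - i))"
      using w_nonneg d_nonneg by (intro member_le_sum[where f="\<lambda>i. w i * d (m - i)"]) auto
    also have "\<dots> = (r1 - 1) * R m + b m" by (rule w_conv_d)
    also have "\<dots> \<le> (r1 - 1) * R n + 1"
      using r1_gt_1 R_mono[OF that] b_le_1 by (intro add_mono mult_left_mono) auto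
    finally have "w m \<le> ((r1 - 1) * R n + 1) * (1 / a 0)"
      using a_0_pos by (simp add: field_simps)
    also have "\<dots> \<le> ((r1 - 1) * R n + 1) * K"
      using K r1_gt_1 R_ge_1[of n] by (intro mult_left_mono) auto
    finally show ?thesis by (simp add: mult.commute)
  qed
  have "R n \<le> (\<Sum>m\<le>n. K * ((r1 - 1) * R n + 1))"
    unfolding R_def[of n] using step by (intro sum_mono) (auto simp: R_def)
  also have "\<dots> = (K * (r1 - 1) * real (Suc n)) * R n + K * real (Suc n)"
    by (simp add: algebra_simps)
  \<comment> \<open>The smallness assumption lets the left side absorb this half of
    \<open>R n\<close>.\<close>
  also have "\<dots> \<le> 1 / 2 * R n + K * real (Suc n)"
    using R_ge_1[of n] small by (intro add_right_mono mult_right_mono) auto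
  finally have "R n \<le> 2 * K * real (Suc n)" by simp
  then have "(r1 - 1) * R n \<le> (r1 - 1) * (2 * K * real (Suc n))"
    using r1_gt_1 by (intro mult_left_mono) auto
  with small have "(r1 - 1) * R n \<le> 1" by (simp add: algebra_simps)
  then have "K * ((r1 - 1) * R n + 1) \<le> K * 2" using K0 by (intro mult_left_mono) auto
  with step[OF mn] show ?thesis by simp
qed

text \<open>With increments at most \<open>2 * K\<close>, replacing \<open>R (n - k)\<close> by
  \<open>R n\<close> in the convolution costs at most \<open>2 * K * k\<close>. Weighted by
  \<open>d k\<close>, this sums to at most \<open>2 * K * t\<close>.\<close>

lemma R_upper:
  assumes s: "\<And>k. (\<Sum>m\<le>k. d m) \<le> s" and t: "\<And>k. (\<Sum>m\<le>k. s - (\<Sum>l\<le>m. d l)) \<le> t"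
    and K: "1 / a 0 \<le> K" and small: "K * (r1 - 1) * real (Suc n) \<le> 1 / 2"
  shows "R n * (s - t / real (Suc n)) \<le> real (Suc n) * (1 + (r1 - 1) * R n) + 2 * K * t"
proof -
  have K0: "0 < K" using K a_0_pos by (intro less_le_trans[of 0 "1 / a 0" K]) auto
  have gap: "R n - 2 * K * real k \<le> R (n - k)" if "k \<le> n" for k
  proof -
    have "R n = R (n - k) + (\<Sum>i\<in>{n - k<..n}. w i)"
      unfolding R_def by (subst sum.union_disjoint[symmetric]) (auto intro: sum.cong)
    also have "(\<Sum>i\<in>{n - k<..n}. w i) \<le> (\<Sum>i\<in>{n - k<..n}. 2 * K)"
      using w_bounded[OF K small] by (intro sum_mono) auto
    also have "\<dots> = 2 * K * real k" using that by simp
    finally show ?thesis by simp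
  qed
  have "R n * (s - t / real (Suc n)) \<le> R n * (\<Sum>k\<le>n. d k)"
    using partial_sums_d_bounds(1)[OF s t] R_ge_1[of n] by (intro mult_left_mono) auto
  also have "\<dots> = (\<Sum>k\<le>n. (R n - 2 * K * real k) * d k) + 2 * K * (\<Sum>k\<le>n. real k * d k)"
    by (simp add: sum_distrib_left sum.distrib[symmetric] algebra_simps)
  also have "\<dots> \<le> (\<Sum>k\<le>n. R (n - k) * d k) + 2 * K * t"
    using gap d_nonneg K0 partial_sums_d_bounds(2)[OF s t]
    by (intro add_mono sum_mono mult_right_mono mult_left_mono) auto
  also have "(\<Sum>k\<le>n. R (n - k) * d k) = (\<Sum>i\<le>n. R i * d (n - i))"
    by (rule sum.reindex_bij_witness[of _ "\<lambda>i. n - i" "\<lambda>i. n - i"]) auto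
  also have "\<dots> = (\<Sum>m\<le>n. (r1 - 1) * R m + b m)" by (rule R_conv_d)
  also have "\<dots> \<le> (\<Sum>m\<le>n. (r1 - 1) * R n + 1)"
    using r1_gt_1 R_mono b_le_1 by (intro sum_mono add_mono mult_left_mono) auto
  also have "\<dots> = real (Suc n) * (1 + (r1 - 1) * R n)" by (simp add: algebra_simps)
  finally show ?thesis by simp
qed

end

section \<open>The number of customers left after one interarrival period\<close>

text \<open>By monotonicity the counted indices form a final segment of \<open>{..<m}\<close>, which
  has \<open>j\<close> or more elements exactly when it contains \<open>m - j\<close>.\<close>

lemma card_upper_tail_ge_iff:
  fixes S :: "nat \<Rightarrow> real"
  assumes mono: "\<And>d e. d \<le> e \<Longrightarrow> e < m \<Longrightarrow> S d \<le> S e" and j: "1 \<le> j" "j \<le> m"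
  shows "j \<le> card {d. d < m \<and> x < S d} \<longleftrightarrow> x < S (m - j)"
proof
  assume "x < S (m - j)"
  then have "{m - j..<m} \<subseteq> {d. d < m \<and> x < S d}"
    using mono by (fastforce intro: less_le_trans)
  then have "card {m - j..<m} \<le> card {d. d < m \<and> x < S d}"
    by (intro card_mono) auto
  then show "j \<le> card {d. d < m \<and> x < S d}" using j by simp
next
  assume *: "j \<le> card {d. d < m \<and> x < S d}"
  show "x < S (m - j)"
  proof (rule ccontr)
    assume nx: "\<not> x < S (m - j)"
    have "m - j < d" if "d < m" "x < S d" for d
    proof (rule ccontr)
      assume "\<not> m - j < d"
      then have "S d \<le> S (m - j)" using j by (intro mono) auto
      with that nx show False by simp
    qed
    then have "{d. d < m \<and> x < S d} \<subseteq> {Suc (m - j)..<m}" by (auto simp: Suc_le_eq)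
    then have "card {d. d < m \<and> x < S d} \<le> card {Suc (m - j)..<m}"
      by (intro card_mono) auto
    with * j show False by simp
  qed
qed

abbreviation services :: "real \<Rightarrow> nat \<Rightarrow> (nat \<Rightarrow> real) measure" where
  "services mu m \<equiv> \<Pi>\<^sub>M k\<in>{..<m}. density lborel (\<lambda>t. ennreal (exponential_density mu t))"

lemma prob_space_services: "0 < mu \<Longrightarrow> prob_space (services mu m)"
  by (intro prob_space_PiM prob_space_exponential_density)

lemma service_measurable:
  assumes "k < m" shows "(\<lambda>s. s k) \<in> borel_measurable (services mu m)"
proof -
  have "(\<lambda>s. s k) \<in> services mu m \<rightarrow>\<^sub>M density lborel (\<lambda>t. ennreal (exponential_density mu t))"
    using assms by (intro measurable_component_singleton) auto
  then show ?thesis by simp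
qed

lemma service_sum_measurable:
  assumes "d < m" shows "(\<lambda>s. \<Sum>k\<le>d. s k) \<in> borel_measurable (services mu m)"
  using assms by (intro borel_measurable_sum service_measurable) auto

lemma service_sum_erlang:
  assumes mu: "0 < mu" and d: "d < m"
  shows "distributed (services mu m) lborel (\<lambda>s. \<Sum>k\<le>d. s k) (erlang_density d mu)"
proof -
  let ?E = "density lborel (\<lambda>t. ennreal (exponential_density mu t))"
  interpret P: prob_space "services mu m" by (rule prob_space_services[OF mu])
  have E: "prob_space ?E" by (rule prob_space_exponential_density[OF mu])
  have meas: "(\<lambda>s. s k) \<in> borel_measurable (services mu m)" if "k \<le> d" for k
    using that d by (intro service_measurable) auto
  have comp: "distr (services mu m) borel (\<lambda>s. s k) = ?E" if "k \<le> d" for k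
  proof -
    have "distr (services mu m) borel (\<lambda>s. s k) = distr (services mu m) ?E (\<lambda>s. s k)"
      by (rule distr_cong) auto
    also have "\<dots> = ?E" using that d E by (intro distr_PiM_component) auto
    finally show ?thesis .
  qed
  \<comment> \<open>Independence is obtained by showing that the joint law of the first
    \<open>d + 1\<close> coordinates is the product of their laws.\<close>
  have "distr (services mu m) (\<Pi>\<^sub>M k\<in>{..d}. borel) (\<lambda>s. \<lambda>k\<in>{..d}. s k)
      = distr (services mu m) (\<Pi>\<^sub>M k\<in>{..d}. ?E) (\<lambda>s. \<lambda>k\<in>{..d}. s k)"
    by (intro distr_cong sets_PiM_cong) auto
  also have "\<dots> = (\<Pi>\<^sub>M k\<in>{..d}. ?E)"
    using d E by (intro distr_PiM_reindex[where f="\<lambda>k. k" and M="\<lambda>_. ?E"]) auto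
  also have "\<dots> = (\<Pi>\<^sub>M k\<in>{..d}. distr (services mu m) borel (\<lambda>s. s k))"
    by (intro PiM_cong) (auto simp: comp)
  finally have ind: "P.indep_vars (\<lambda>_. borel) (\<lambda>k s. s k) {..d}"
    using meas by (subst P.indep_vars_iff_distr_eq_PiM') auto
  have dist: "distributed (services mu m) lborel (\<lambda>s. s k) (exponential_density mu)"
    if "k \<in> {..d}" for k
  proof -
    have "distr (services mu m) lborel (\<lambda>s. s k) = distr (services mu m) borel (\<lambda>s. s k)"
      by (rule distr_cong) auto
    then show ?thesis
      using comp[of k] meas[of k] that unfolding distributed_def by auto
  qed
  have "distributed (services mu m) lborel (\<lambda>s. \<Sum>k\<in>{..d}. s k) (erlang_density (card {..d} - 1) mu)"
    using P.exponential_distributed_sum[OF _ _ mu dist ind] by simp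
  then show ?thesis by simp
qed

lemma services_nonneg_AE:
  assumes mu: "0 < mu"
  shows "AE s in services mu m. \<forall>k\<in>{..<m}. 0 \<le> s k"
proof (rule AE_finite_allI)
  fix k assume k: "k \<in> {..<m}"
  show "AE s in services mu m. 0 \<le> s k"
  proof (rule AE_PiM_component[OF prob_space_exponential_density[OF mu] k])
    show "AE t in density lborel (\<lambda>t. ennreal (exponential_density mu t)). 0 \<le> t"
      by (subst AE_density) (auto simp: exponential_density_def intro!: AE_I2)
  qed
qed simp

lemma still_present_measurable [measurable]:
  "(\<lambda>s. still_present m (x, s)) \<in> services mu m \<rightarrow>\<^sub>M count_space UNIV"
proof -
  note service_sum_measurable [measurable]
  have "{s \<in> space (services mu m). d \<in> {d. d < m \<and> x < (\<Sum>k\<le>d. s k)}} \<in> sets (services mu m)" for d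
    by (cases "d < m") simp_all
  then show ?thesis unfolding still_present_def prod.case by (rule measurable_card)
qed

lemma still_present_le: "still_present m w \<le> m"
proof -
  have "card {d. d < m \<and> x < (\<Sum>k\<le>d. s k)} \<le> card {..<m}" for x and s :: "nat \<Rightarrow> real"
    by (intro card_mono) auto
  then show ?thesis by (cases w) (simp add: still_present_def)
qed

text \<open>At least \<open>j\<close> customers remain when customer number \<open>m - j\<close> has
  not left, that is, when a sum of \<open>m - j + 1\<close> exponential times exceeds
  \<open>x\<close>. The Erlang tail is a Poisson distribution function.\<close>

lemma still_present_ge_prob:
  assumes mu: "0 < mu" and x: "0 \<le> x" and j: "1 \<le> j" "j \<le> m"
  shows "measure (services mu m) {s \<in> space (services mu m). j \<le> still_present m (x, s)}
    = (\<Sum>k\<le>m - j. poisson_tail 0 k (mu * x))"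
proof -
  interpret P: prob_space "services mu m" by (rule prob_space_services[OF mu])
  have dist: "distributed (services mu m) lborel (\<lambda>s. \<Sum>k\<le>m - j. s k) (erlang_density (m - j) mu)"
    using j by (intro service_sum_erlang[OF mu]) auto
  have [measurable]: "(\<lambda>s. \<Sum>k\<le>m - j. s k) \<in> borel_measurable (services mu m)"
    using j by (intro service_sum_measurable) auto
  \<comment> \<open>The equivalence holds almost surely, as departure times are ordered only for
    nonnegative service times.\<close>
  have "AE s in services mu m. j \<le> still_present m (x, s) \<longleftrightarrow> x < (\<Sum>k\<le>m - j. s k)"
    using services_nonneg_AE[OF mu]
  proof eventually_elim
    case (elim s)
    have "(\<Sum>k\<le>d. s k) \<le> (\<Sum>k\<le>e. s k)" if "d \<le> e" "e < m" for d e
      using that elim by (intro sum_mono2) auto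
    from card_upper_tail_ge_iff[OF this j] show ?case
      by (simp add: still_present_def)
  qed
  then have "measure (services mu m) {s \<in> space (services mu m). j \<le> still_present m (x, s)}
    = measure (services mu m) {s \<in> space (services mu m). x < (\<Sum>k\<le>m - j. s k)}"
    by (intro measure_eq_AE) auto
  also have "\<dots> = 1 - erlang_CDF (m - j) mu x"
    by (rule P.erlang_distributed_gt[OF dist mu x])
  also have "\<dots> = (\<Sum>k\<le>m - j. poisson_tail 0 k (mu * x))"
    using x by (simp add: erlang_CDF_def del: fact_Suc)
  finally show ?thesis .
qed

lemma still_present_prob:
  assumes mu: "0 < mu" and x: "0 \<le> x" and j: "1 \<le> j" "j \<le> m"
  shows "measure (services mu m) {s \<in> space (services mu m). still_present m (x, s) = j}
    = poisson_tail 0 (m - j) (mu * x)"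
proof -
  interpret P: prob_space "services mu m" by (rule prob_space_services[OF mu])
  define G where "G j = {s \<in> space (services mu m). j \<le> still_present m (x, s)}" for j
  have [measurable]: "G j \<in> sets (services mu m)" for j
    unfolding G_def by measurable
  have "{s \<in> space (services mu m). still_present m (x, s) = j} = G j - G (Suc j)"
    unfolding G_def by (rule set_eqI, simp only: mem_Collect_eq Diff_iff, arith)
  also have "measure (services mu m) \<dots> = measure (services mu m) (G j) - measure (services mu m) (G (Suc j))"
    by (rule P.finite_measure_Diff) (simp_all add: G_def Collect_mono_iff Suc_le_eq less_imp_le)
  also have "\<dots> = poisson_tail 0 (m - j) (mu * x)"
  \<comment> \<open>For \<open>j = m\<close> the tail formula does not cover \<open>Suc j\<close>,
    but then \<open>G (Suc j)\<close> is empty.\<close>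
  proof (cases "j = m")
    case True
    have "\<not> Suc j \<le> still_present m (x, s)" for s
      using still_present_le[of m "(x, s)"] True by linarith
    then have "G (Suc j) = {}" by (simp add: G_def)
    moreover have "measure (services mu m) (G j) = poisson_tail 0 0 (mu * x)"
      using still_present_ge_prob[OF mu x j] True unfolding G_def
      by (simp only: diff_self_eq_0 atMost_0 sum.insert finite.emptyI empty_iff sum.empty add_0_right simp_thms)
    ultimately show ?thesis using True
      by (simp only: measure_empty diff_self_eq_0 diff_0_right)
  next
    case False
    then have eq: "m - j = Suc (m - Suc j)" and j': "1 \<le> Suc j" "Suc j \<le> m" using j by linarith+
    show ?thesis
      using still_present_ge_prob[OF mu x j] still_present_ge_prob[OF mu x j']
      unfolding G_def eq sum.atMost_Suc by linarith
  qed
  finally show ?thesis .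
qed

lemma still_present_measurable_pair:
  assumes "sets A = sets borel"
  shows "still_present m \<in> period_space A mu m \<rightarrow>\<^sub>M count_space UNIV"
proof -
  note assms [measurable_cong]
  have [measurable]: "(\<lambda>w. \<Sum>k\<le>d. snd w k) \<in> borel_measurable (A \<Otimes>\<^sub>M services mu m)" if "d < m" for d
    using that by (intro measurable_compose[OF measurable_snd service_sum_measurable])
  have [measurable]: "fst \<in> borel_measurable (A \<Otimes>\<^sub>M services mu m)"
    by measurable
  have "{w \<in> space (A \<Otimes>\<^sub>M services mu m). d \<in> {d. d < m \<and> fst w < (\<Sum>k\<le>d. snd w k)}}
      \<in> sets (A \<Otimes>\<^sub>M services mu m)" for d
    by (cases "d < m") simp_all
  then show ?thesis unfolding still_present_def case_prod_beta period_space_def by (rule measurable_card)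
qed

section \<open>Tail moments under the interarrival law\<close>

text \<open>Level 0 is the sequence \<open>a\<close> of completion probabilities; levels 1 and 2
  become \<open>c\<close> and \<open>d\<close>, and level 3 the tails of \<open>d\<close>.\<close>

definition tail_moment :: "real measure \<Rightarrow> real \<Rightarrow> nat \<Rightarrow> nat \<Rightarrow> real" where
  "tail_moment A mu r k = (\<integral>x. poisson_tail r k (mu * x) \<partial>A)"

context GI_M_1
begin

lemma prob_space_period: "prob_space (period_space A mu m)"
  unfolding period_space_def
  by (intro prob_space_pair prob_space_services mu_pos prob_space_axioms)

lemma poisson_tail_scaled_nonneg: "AE x in A. 0 \<le> poisson_tail r k (mu * x)"
  using interarrival_nonneg
  by eventually_elim (rule poisson_tail_nonneg, use mu_pos in simp)

lemma tail_moment_nonneg: "0 \<le> tail_moment A mu r k"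
  unfolding tail_moment_def by (rule integral_nonneg_AE[OF poisson_tail_scaled_nonneg])

lemma poisson_tail_scaled_measurable [measurable]:
  "(\<lambda>x. poisson_tail r k (mu * x)) \<in> borel_measurable A"
  by measurable

lemma integrable_poisson_weight: "integrable A (\<lambda>x. poisson_tail 0 k (mu * x))"
proof (rule integrable_const_bound[where B=1])
  show "AE x in A. norm (poisson_tail 0 k (mu * x)) \<le> 1"
    using interarrival_nonneg
  proof eventually_elim
    case (elim x)
    then have "0 \<le> mu * x" using mu_pos by simp
    from poisson_weight_le_1[OF this, of k] poisson_tail_nonneg[OF this, of 0 k]
    show ?case by (simp only: real_norm_def abs_of_nonneg)
  qed
qed (rule poisson_tail_scaled_measurable)

lemma integrable_poisson_tail:
  assumes "integrable A (\<lambda>x. x ^ r)"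
  shows "integrable A (\<lambda>x. poisson_tail (Suc r) k (mu * x))"
proof (rule Bochner_Integration.integrable_bound)
  show "integrable A (\<lambda>x. mu ^ r / fact r * x ^ r)" using assms by simp
  show "AE x in A. norm (poisson_tail (Suc r) k (mu * x)) \<le> norm (mu ^ r / fact r * x ^ r)"
    using interarrival_nonneg
  proof eventually_elim
    case (elim x)
    then have y: "0 \<le> mu * x" using mu_pos by simp
    have "norm (poisson_tail (Suc r) k (mu * x)) = poisson_tail (Suc r) k (mu * x)"
      using poisson_tail_nonneg[OF y, of "Suc r" k] by (simp only: real_norm_def abs_of_nonneg)
    also have "\<dots> \<le> (mu * x) ^ r / fact r" by (rule poisson_tail_le[OF y])
    also have "\<dots> = mu ^ r / fact r * x ^ r" by (simp add: power_mult_distrib)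
    also have "\<dots> \<le> norm (mu ^ r / fact r * x ^ r)"
      unfolding real_norm_def by (rule abs_ge_self)
    finally show ?case .
  qed
qed (rule poisson_tail_scaled_measurable)

lemma tail_moment_Suc:
  assumes "integrable A (\<lambda>x. x ^ r)"
    and "\<And>m. integrable A (\<lambda>x. poisson_tail r m (mu * x))"
  shows "tail_moment A mu (Suc r) k = rho_moment A mu r / fact r - (\<Sum>m\<le>k. tail_moment A mu r m)"
proof -
  have "tail_moment A mu (Suc r) k
      = (\<integral>x. (mu * x) ^ r / fact r \<partial>A) - (\<integral>x. (\<Sum>m\<le>k. poisson_tail r m (mu * x)) \<partial>A)"
    unfolding tail_moment_def poisson_tail.simps(2)
    using assms by (intro Bochner_Integration.integral_diff) (simp_all add: power_mult_distrib)
  also have "(\<integral>x. (mu * x) ^ r / fact r \<partial>A) = rho_moment A mu r / fact r"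
    by (simp add: power_mult_distrib rho_moment_def)
  also have "(\<integral>x. (\<Sum>m\<le>k. poisson_tail r m (mu * x)) \<partial>A) = (\<Sum>m\<le>k. tail_moment A mu r m)"
    unfolding tail_moment_def using assms(2) by (intro Bochner_Integration.integral_sum) auto
  finally show ?thesis .
qed

text \<open>Nonnegativity of the next level gives the bound without a limit in
  \<open>k\<close>.\<close>

lemma sum_tail_moment_le:
  assumes "integrable A (\<lambda>x. x ^ r)"
    and "\<And>m. integrable A (\<lambda>x. poisson_tail r m (mu * x))"
  shows "(\<Sum>m\<le>k. tail_moment A mu r m) \<le> rho_moment A mu r / fact r"
  using tail_moment_Suc[OF assms] tail_moment_nonneg[of "Suc r" k] by simp

lemma integrable_power_le:
  assumes "integrable A (\<lambda>x. x ^ s)" and "r \<le> s"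
  shows "integrable A (\<lambda>x. x ^ r)"
proof (rule Bochner_Integration.integrable_bound)
  show "integrable A (\<lambda>x. 1 + x ^ s)" using assms by simp
  show "AE x in A. norm (x ^ r) \<le> norm (1 + x ^ s)"
    using interarrival_nonneg
  proof eventually_elim
    case (elim x)
    have "x ^ r \<le> 1 + x ^ s"
    proof (cases "x \<le> 1")
      case True
      then show ?thesis using elim power_le_one[of x r] by (simp add: add_increasing2)
    next
      case False
      then have "x ^ r \<le> x ^ s" by (intro power_increasing assms(2)) auto
      then show ?thesis by simp
    qed
    then show ?case using elim by simp
  qed
qed measurable

lemma rho_moment_0: "rho_moment A mu 0 = 1"
  using prob_space by (simp add: rho_moment_def)

lemma rho_moment_1: "rho_moment A mu 1 = mu / lam"
  by (simp add: rho_moment_def interarrival_mean)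

lemma integrable_power_0: "integrable A (\<lambda>x. x ^ 0)" by simp
lemma integrable_power_1: "integrable A (\<lambda>x. x ^ Suc 0)" using interarrival_integrable by simp

text \<open>Items 1, 2, 3 are levels 0, 1, 2; level \<open>r + 1\<close> is dominated by the
  \<open>r\<close>-th moment.\<close>

lemmas integrable_levels = integrable_poisson_weight
  integrable_poisson_tail[OF integrable_power_0] integrable_poisson_tail[OF integrable_power_1]

text \<open>Jensen's inequality, through the tangent of the exponential at the mean. It bounds
  \<open>1 / a 0\<close> uniformly in the system.\<close>

lemma tail_moment_0_0_ge: "exp (- rho_moment A mu 1) \<le> tail_moment A mu 0 0"
proof -
  let ?r = "rho_moment A mu 1"
  have mean: "(\<integral>x. mu * x \<partial>A) = ?r" by (simp add: rho_moment_def)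
  have "exp (- ?r) = (\<integral>x. exp (- ?r) * (1 + ?r - mu * x) \<partial>A)"
    using interarrival_integrable mean prob_space by simp
  also have "\<dots> \<le> (\<integral>x. poisson_tail 0 0 (mu * x) \<partial>A)"
  proof (rule integral_mono)
    fix x
    have "exp (- ?r) * (1 + (?r - mu * x)) \<le> exp (- ?r) * exp (?r - mu * x)"
      by (intro mult_left_mono exp_ge_add_one_self) simp
    also have "\<dots> = exp (- (mu * x))" by (simp flip: exp_add)
    finally show "exp (- ?r) * (1 + ?r - mu * x) \<le> poisson_tail 0 0 (mu * x)"
      by (simp add: add_diff_eq)
  qed (use interarrival_integrable integrable_poisson_weight in \<open>auto simp del: poisson_tail.simps\<close>)
  finally show ?thesis unfolding tail_moment_def .
qed

lemma kernel_sequence_tail_moment: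
  assumes "lam < mu"
  shows "kernel_sequence (tail_moment A mu 0) (rho_moment A mu 1)"
proof
  have tail1: "tail_moment A mu 1 k = 1 - (\<Sum>l\<le>k. tail_moment A mu 0 l)" for k
    using tail_moment_Suc[OF integrable_power_0 integrable_levels(1)] by (simp add: rho_moment_0)
  show "0 \<le> tail_moment A mu 0 k" for k by (rule tail_moment_nonneg)
  show "0 < tail_moment A mu 0 0"
    using tail_moment_0_0_ge by (rule less_le_trans[rotated]) simp
  show "(\<Sum>m\<le>k. tail_moment A mu 0 m) \<le> 1" for k
    using tail_moment_nonneg[of 1 k] tail1[of k] by simp
  show "(\<Sum>m\<le>k. 1 - (\<Sum>l\<le>m. tail_moment A mu 0 l)) \<le> rho_moment A mu 1" for k
    using sum_tail_moment_le[OF integrable_power_1 integrable_levels(2)]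
    unfolding tail1[symmetric] by simp
  show "1 < rho_moment A mu 1" using assms lam_pos unfolding rho_moment_1 by simp
qed

section \<open>Transition probabilities and the stationary distribution\<close>

text \<open>Reaching \<open>j \<ge> 1\<close> from \<open>m\<close> customers means exactly
  \<open>m - j\<close> completions; conditioning on the period length gives a Poisson weight. State
  0 is excluded because the server may fall idle.\<close>

lemma transition_prob_eq:
  assumes j: "1 \<le> j"
  shows "transition_prob A mu n i j
    = (if j \<le> min (i + 1) n then tail_moment A mu 0 (min (i + 1) n - j) else 0)"
proof -
  define m where "m = min (i + 1) n"
  have T: "transition_prob A mu n i j
      = measure (period_space A mu m) {w \<in> space (period_space A mu m). still_present m w = j}"
    by (simp add: transition_prob_def m_def Let_def)
  show ?thesis
  proof (cases "j \<le> m")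
    case False
    then have "still_present m w \<noteq> j" for w using still_present_le[of m w] by linarith
    then show ?thesis using False T unfolding m_def[symmetric] by simp
  next
    case True
    interpret S: prob_space "services mu m" by (rule prob_space_services[OF mu_pos])
    interpret Q: prob_space "period_space A mu m" by (rule prob_space_period)
    define X where "X = {w \<in> space (period_space A mu m). still_present m w = j}"
    have X: "X \<in> sets (A \<Otimes>\<^sub>M services mu m)"
      using still_present_measurable_pair[OF events_eq_borel, of m mu]
      unfolding X_def period_space_def by measurable
    have "emeasure (period_space A mu m) X = (\<integral>\<^sup>+x. emeasure (services mu m) (Pair x -` X) \<partial>A)"
      unfolding period_space_def by (rule S.emeasure_pair_measure_alt[OF X])
    also have "\<dots> = (\<integral>\<^sup>+x. ennreal (poisson_tail 0 (m - j) (mu * x)) \<partial>A)"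
    proof (rule nn_integral_cong_AE)
      show "AE x in A. emeasure (services mu m) (Pair x -` X) = ennreal (poisson_tail 0 (m - j) (mu * x))"
        using interarrival_nonneg
      proof eventually_elim
        case (elim x)
        have "Pair x -` X = {s \<in> space (services mu m). still_present m (x, s) = j}"
          by (auto simp: X_def period_space_def space_pair_measure)
        then show ?case
          using still_present_prob[OF mu_pos elim j True] by (simp only: S.emeasure_eq_measure)
      qed
    qed
    also have "\<dots> = ennreal (tail_moment A mu 0 (m - j))"
      unfolding tail_moment_def
      by (rule nn_integral_eq_integral[OF integrable_poisson_weight poisson_tail_scaled_nonneg])
    finally have "measure (period_space A mu m) X = tail_moment A mu 0 (m - j)"
      by (simp add: Q.emeasure_eq_measure tail_moment_nonneg)
    then show ?thesis using True T unfolding m_def[symmetric] X_def by simp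
  qed
qed

lemma sum_transition_prob: "(\<Sum>j\<le>n. transition_prob A mu n i j) = 1"
proof -
  define m where "m = min (i + 1) n"
  interpret Q: prob_space "period_space A mu m" by (rule prob_space_period)
  define X where "X j = {w \<in> space (period_space A mu m). still_present m w = j}" for j
  have X: "X j \<in> sets (period_space A mu m)" for j
    using still_present_measurable_pair[OF events_eq_borel, of m mu]
    unfolding X_def by measurable
  have "(\<Sum>j\<le>n. transition_prob A mu n i j) = (\<Sum>j\<le>n. measure (period_space A mu m) (X j))"
    by (simp add: transition_prob_def m_def X_def Let_def)
  also have "\<dots> = measure (period_space A mu m) (\<Union>j\<le>n. X j)"
    using X by (intro Q.finite_measure_finite_Union[symmetric]) (auto simp: disjoint_family_on_def X_def)
  also have "(\<Union>j\<le>n. X j) = space (period_space A mu m)"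
    using still_present_le[of m] by (auto simp: X_def m_def intro: order_trans)
  finally show ?thesis by (simp add: Q.prob_space)
qed

text \<open>State \<open>n - l\<close> with \<open>l \<ge> 1\<close> reaches \<open>n - i\<close> by
  \<open>Suc i - l\<close> completions. State \<open>n\<close> stands apart: its arrival is lost, so
  it needs \<open>i\<close>.\<close>

lemma stationary_flow:
  assumes i: "i < n"
  shows "(\<Sum>k\<le>n. q k * transition_prob A mu n k (n - i))
    = q n * tail_moment A mu 0 i + (\<Sum>l\<in>{1..Suc i}. q (n - l) * tail_moment A mu 0 (Suc i - l))"
proof -
  have "(\<Sum>k\<le>n. q k * transition_prob A mu n k (n - i))
      = (\<Sum>k<n. q k * transition_prob A mu n k (n - i)) + q n * transition_prob A mu n n (n - i)"
    by (simp add: lessThan_Suc_atMost[symmetric])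
  also have "transition_prob A mu n n (n - i) = tail_moment A mu 0 i"
    using i by (simp add: transition_prob_eq)
  \<comment> \<open>One step climbs by at most one, so lower states contribute nothing.\<close>
  also have "(\<Sum>k<n. q k * transition_prob A mu n k (n - i))
      = (\<Sum>k\<in>{n - Suc i..<n}. q k * transition_prob A mu n k (n - i))"
    using i by (intro sum.mono_neutral_right) (auto simp: transition_prob_eq)
  also have "\<dots> = (\<Sum>l\<in>{1..Suc i}. q (n - l) * tail_moment A mu 0 (Suc i - l))"
  proof (rule sum.reindex_bij_witness[of _ "\<lambda>l. n - l" "\<lambda>k. n - k"])
    fix k assume k: "k \<in> {n - Suc i..<n}"
    then have "min (k + 1) n - (n - i) = Suc i - (n - k)" "n - i \<le> min (k + 1) n" using i by auto
    then show "q (n - (n - k)) * tail_moment A mu 0 (Suc i - (n - k)) = q k * transition_prob A mu n k (n - i)"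
      using k i by (simp add: transition_prob_eq)
  qed (use i in auto)
  finally show ?thesis by simp
qed

text \<open>The equations for states \<open>n, ..., 1\<close> form the recursion
  \<open>w_balance\<close>, which forces \<open>q (n - l) = q n * w l\<close>; normalization then
  yields \<open>q n\<close>. Conversely, reversed and normalized \<open>w\<close> is
  stationary.\<close>

lemma loss_prob_eq:
  assumes less: "lam < mu" and n: "1 \<le> n"
  shows "loss_prob A mu n
    = 1 / kernel_sequence.R (tail_moment A mu 0) n"
proof -
  let ?a = "tail_moment A mu 0"
  interpret kernel_sequence ?a "rho_moment A mu 1"
    by (rule kernel_sequence_tail_moment[OF less])
  have Rpos: "0 < R n" using R_ge_1[of n] by simp
  have reflect: "(\<Sum>j\<le>n. f (n - j)) = (\<Sum>j\<le>n. f j)" for f :: "nat \<Rightarrow> real"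
    by (rule sum.reindex_bij_witness[of _ "\<lambda>i. n - i" "\<lambda>i. n - i"]) auto
  \<comment> \<open>Values of \<open>q\<close> beyond \<open>n\<close> are unconstrained, so
    uniqueness is claimed for \<open>q n\<close>, the value that \<open>THE\<close> selects.\<close>
  have unique: "q n = 1 / R n" if q: "stationary_dist A mu n q" for q
  proof -
    have total: "(\<Sum>j\<le>n. q j) = 1"
      using q unfolding stationary_dist_def by blast
    have flow: "q j = (\<Sum>i\<le>n. q i * transition_prob A mu n i j)" if "j \<le> n" for j
      using q that unfolding stationary_dist_def by blast
    have "q (n - l) = q n * w l" if "l \<le> n" for l
      using that
    proof (induction l rule: less_induct)
      case (less l)
      show ?case
      proof (cases l)
        case 0
        then show ?thesis by (simp add: w_0)
      next
        case (Suc i)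
        have "q (n - i) = q n * ?a i + (\<Sum>l\<in>{1..Suc i}. q (n - l) * ?a (Suc i - l))"
          using flow[of "n - i"] stationary_flow[of i n q] less.prems Suc by simp
        also have "(\<Sum>l\<in>{1..Suc i}. q (n - l) * ?a (Suc i - l))
            = (\<Sum>l\<in>{1..i}. q (n - l) * ?a (Suc i - l)) + q (n - Suc i) * ?a 0" by simp
        also have "(\<Sum>l\<in>{1..i}. q (n - l) * ?a (Suc i - l))
            = (\<Sum>l\<in>{1..i}. q n * (w l * ?a (Suc i - l)))"
          using less Suc by (intro sum.cong) auto
        finally have 1: "q (n - Suc i) * ?a 0
            = q (n - i) - q n * ?a i - q n * (\<Sum>l\<in>{1..i}. w l * ?a (Suc i - l))"
          by (simp add: sum_distrib_left)
        have 2: "w (Suc i) * ?a 0 = w i - ?a i - (\<Sum>l\<in>{1..i}. w l * ?a (Suc i - l))"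
          using w_balance[of i] by simp
        have 3: "q (n - i) = q n * w i" using less Suc by simp
        have "q (n - Suc i) * ?a 0 = q n * (w (Suc i) * ?a 0)"
          unfolding 1 2 3 by (simp only: right_diff_distrib)
        then show ?thesis using a_0_pos Suc by simp
      qed
    qed
    then have "(\<Sum>l\<le>n. q (n - l)) = q n * R n"
      by (simp add: R_def sum_distrib_left)
    then have "q n * R n = 1" using total reflect[of q] by simp
    then show ?thesis using Rpos by (simp add: field_simps)
  qed
  define q where "q j = w (n - j) / R n" for j
  have qn: "q n = 1 / R n" by (simp add: q_def w_0)
  have sum_q: "(\<Sum>j\<le>n. q j) = 1"
    using reflect[of w] Rpos by (simp add: q_def sum_divide_distrib[symmetric] R_def[symmetric])
  have pos: "q j = (\<Sum>i\<le>n. q i * transition_prob A mu n i j)" if j: "1 \<le> j" "j \<le> n" for j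
  proof -
    define i where "i = n - j"
    have i: "i < n" "j = n - i" using j by (auto simp: i_def)
    have "(\<Sum>k\<le>n. q k * transition_prob A mu n k (n - i))
      = q n * ?a i + (\<Sum>l\<in>{1..Suc i}. q (n - l) * ?a (Suc i - l))"
      by (rule stationary_flow[OF i(1)])
    also have "(\<Sum>l\<in>{1..Suc i}. q (n - l) * ?a (Suc i - l))
        = (\<Sum>l\<in>{1..Suc i}. w l * ?a (Suc i - l)) / R n"
      unfolding sum_divide_distrib using i(1) by (intro sum.cong) (auto simp: q_def)
    also have "q n * ?a i + \<dots> = w i / R n"
      using w_balance[of i] by (simp add: qn add_divide_distrib)
    finally show ?thesis using i by (simp add: q_def)
  qed
  \<comment> \<open>Rows sum to 1, so the equation for state 0 follows by subtracting all the others
    from the total.\<close>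
  have zero: "q 0 = (\<Sum>i\<le>n. q i * transition_prob A mu n i 0)"
  proof -
    have "(\<Sum>j\<le>n. \<Sum>i\<le>n. q i * transition_prob A mu n i j)
        = (\<Sum>i\<le>n. q i * (\<Sum>j\<le>n. transition_prob A mu n i j))"
      unfolding sum_distrib_left by (rule sum.swap)
    also have "\<dots> = (\<Sum>j\<le>n. q j)" by (simp add: sum_transition_prob)
    finally have total: "(\<Sum>j\<le>n. q j) = (\<Sum>j\<le>n. \<Sum>i\<le>n. q i * transition_prob A mu n i j)" ..
    have split: "(\<Sum>j\<le>n. f j) = f 0 + (\<Sum>j\<in>{1..n}. f j)" for f :: "nat \<Rightarrow> real"
      by (simp add: sum.atLeast_Suc_atMost atMost_atLeast0)
    have "(\<Sum>j\<in>{1..n}. q j) = (\<Sum>j\<in>{1..n}. \<Sum>i\<le>n. q i * transition_prob A mu n i j)"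
      using pos by (intro sum.cong) auto
    with total show ?thesis unfolding split[of q] split[of "\<lambda>j. \<Sum>i\<le>n. q i * transition_prob A mu n i j"]
      by linarith
  qed
  have "q j = (\<Sum>i\<le>n. q i * transition_prob A mu n i j)" if "j \<le> n" for j
    using zero pos[of j] that by (cases "j = 0") auto
  moreover have "0 \<le> q j" for j using w_nonneg Rpos by (simp add: q_def)
  ultimately have stat: "stationary_dist A mu n q"
    using sum_q unfolding stationary_dist_def by blast
  show ?thesis unfolding loss_prob_def
  proof (rule the_equality)
    show "\<exists>q. stationary_dist A mu n q \<and> 1 / R n = q n" using stat qn by metis
    show "p = 1 / R n" if "\<exists>q. stationary_dist A mu n q \<and> p = q n" for p
      using that unique by blast
  qed
qed

section \<open>Two-sided bounds for the loss probability\<close>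

text \<open>These are \<open>R_lower\<close> and \<open>R_upper\<close> divided by
  \<open>R n\<close>. The constant \<open>K\<close> dominates \<open>1 / a 0\<close> by the Jensen
  bound.\<close>

lemma loss_prob_bounds:
  assumes less: "lam < mu" and n: "1 \<le> n" and third: "integrable A (\<lambda>x. x ^ 3)"
    and K: "exp (rho_moment A mu 1) \<le> K"
    and small: "K * (rho_moment A mu 1 - 1) * real (Suc n) \<le> 1 / 2"
  shows "(real (Suc n) - rho_moment A mu 1) * loss_prob A mu n \<le> rho_moment A mu 2 / 2"
    and "rho_moment A mu 2 / 2 \<le> real (Suc n) * loss_prob A mu n
      + (rho_moment A mu 1 - 1) * real (Suc n) + rho_moment A mu 3 / 6 / real (Suc n)
      + K * rho_moment A mu 3 / 3 * loss_prob A mu n"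
    and "0 < loss_prob A mu n" and "loss_prob A mu n \<le> 1"
proof -
  let ?a = "tail_moment A mu 0"
  interpret kernel_sequence ?a "rho_moment A mu 1"
    by (rule kernel_sequence_tail_moment[OF less])
  have p: "loss_prob A mu n = 1 / R n" by (rule loss_prob_eq[OF less n])
  have Rpos: "0 < R n" using R_ge_1[of n] by simp
  then show "0 < loss_prob A mu n" by (simp add: p)
  show "loss_prob A mu n \<le> 1" using R_ge_1[of n] by (simp add: p)
  have int2: "integrable A (\<lambda>x. x ^ 2)" by (rule integrable_power_le[OF third]) simp
  have tail1: "tail_moment A mu 1 = c"
    using tail_moment_Suc[OF integrable_power_0 integrable_levels(1)]
    by (simp add: fun_eq_iff rho_moment_0 c_def b_def)
  have tail2: "tail_moment A mu 2 k = d k" for k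
    using tail_moment_Suc[OF integrable_power_1 integrable_levels(2), of k]
    unfolding d_def tail1[symmetric] numeral_2_eq_2 by simp
  have levels: "integrable A (\<lambda>x. poisson_tail 2 m (mu * x))" "integrable A (\<lambda>x. poisson_tail 3 m (mu * x))" for m
    using integrable_levels(3)[of m] integrable_poisson_tail[OF int2, of m]
    by (simp_all only: numeral_2_eq_2 numeral_3_eq_3)
  define s t where "s = rho_moment A mu 2 / 2" and "t = rho_moment A mu 3 / 6"
  have tail3: "tail_moment A mu 3 m = s - (\<Sum>l\<le>m. d l)" for m
    using tail_moment_Suc[OF int2 levels(1), of m] tail2 by (simp add: s_def)
  have s: "(\<Sum>m\<le>k. d m) \<le> s" for k
    using tail_moment_nonneg[of 3 k] by (simp add: tail3)
  have t: "(\<Sum>m\<le>k. s - (\<Sum>l\<le>m. d l)) \<le> t" for k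
  proof -
    have "(fact 3 :: real) = 6" by (simp add: numeral_3_eq_3)
    then show ?thesis using sum_tail_moment_le[OF third levels(2), of k] by (simp only: tail3 t_def)
  qed
  have "1 / ?a 0 \<le> 1 / exp (- rho_moment A mu 1)"
    by (intro divide_left_mono tail_moment_0_0_ge mult_pos_pos a_0_pos) auto
  with K have K': "1 / ?a 0 \<le> K" by (simp add: exp_minus field_simps)
  show "(real (Suc n) - rho_moment A mu 1) * loss_prob A mu n \<le> rho_moment A mu 2 / 2"
    using R_lower[OF s, of n] Rpos by (simp add: p s_def[symmetric] field_simps)
  have "R n * s \<le> R n * (real (Suc n) * (1 / R n) + (rho_moment A mu 1 - 1) * real (Suc n)
      + t / real (Suc n) + 2 * K * t * (1 / R n))"
    using R_upper[OF s t K' small] Rpos by (simp add: algebra_simps del: of_nat_Suc)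
  then have "s \<le> real (Suc n) * (1 / R n) + (rho_moment A mu 1 - 1) * real (Suc n)
      + t / real (Suc n) + 2 * K * t * (1 / R n)"
    using Rpos by (simp only: mult_le_cancel_left_pos)
  then show "rho_moment A mu 2 / 2 \<le> real (Suc n) * loss_prob A mu n
      + (rho_moment A mu 1 - 1) * real (Suc n) + rho_moment A mu 3 / 6 / real (Suc n)
      + K * rho_moment A mu 3 / 3 * loss_prob A mu n"
    by (simp add: p s_def t_def)
qed

end

section \<open>Passage to the limit\<close>

theorem theorem3p5:
  fixes A :: "nat \<Rightarrow> real measure"
    and lam mu eps :: "nat \<Rightarrow> real"
    and rho2_lim :: real
  assumes queue: "\<And>n. n \<ge> 1 \<Longrightarrow> GI_M_1 (A n) (lam n) (mu n)"
    and load: "\<And>n. n \<ge> 1 \<Longrightarrow> lam n / mu n = 1 - eps n"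
    and eps_pos: "\<And>n. n \<ge> 1 \<Longrightarrow> eps n > 0"
    and eps_lim: "eps \<longlonglongrightarrow> 0"
    and eps_n_lim: "(\<lambda>n. eps n * real n) \<longlonglongrightarrow> 0"
    and third_moment: "\<And>n. n \<ge> 1 \<Longrightarrow> integrable (A n) (\<lambda>x. x ^ 3)"
    and rho3_bounded: "Bseq (\<lambda>n. rho_moment (A n) (mu n) 3)"
    and rho2_lim: "(\<lambda>n. rho_moment (A n) (mu n) 2) \<longlonglongrightarrow> rho2_lim"
  shows "(\<lambda>n. loss_prob (A n) (mu n) n - rho2_lim / (2 * real n)) \<in> o(\<lambda>n. 1 / real n)"
proof -
  define p where "p n = loss_prob (A n) (mu n) n" for n
  define r where "r n = rho_moment (A n) (mu n) 1" for n
  define r2 where "r2 n = rho_moment (A n) (mu n) 2" for n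
  define r3 where "r3 n = rho_moment (A n) (mu n) 3" for n
  \<comment> \<open>Since \<open>r n\<close> tends to 1, eventually \<open>r n < 2\<close> and
    \<open>exp (r n) \<le> K\<close>.\<close>
  define K :: real where "K = exp 2"
  obtain B where B: "\<And>n. norm (r3 n) \<le> B"
    using rho3_bounded unfolding r3_def by (auto simp: Bseq_def)
  have r_eq: "r n = 1 / (1 - eps n)" if n: "n \<ge> 1" for n
  proof -
    interpret GI_M_1 "A n" "lam n" "mu n" by (rule queue[OF n])
    show ?thesis unfolding r_def rho_moment_1 load[OF n, symmetric] by simp
  qed
  have "(\<lambda>n. 1 / (1 - eps n)) \<longlonglongrightarrow> 1 / (1 - 0)"
    by (intro tendsto_intros eps_lim) simp
  moreover have "eventually (\<lambda>n. 1 / (1 - eps n) = r n) sequentially"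
    using eventually_ge_at_top[of 1] by eventually_elim (simp add: r_eq)
  ultimately have r_lim: "r \<longlonglongrightarrow> 1" by (simp add: tendsto_cong)
  \<comment> \<open>From \<open>r n = 1 / (1 - eps n)\<close> follows
    \<open>r n - 1 = eps n * r n\<close>.\<close>
  have "(\<lambda>n. (eps n * real n + eps n) * r n) \<longlonglongrightarrow> (0 + 0) * 1"
    by (intro tendsto_intros eps_n_lim eps_lim r_lim)
  moreover have "eventually (\<lambda>n. (eps n * real n + eps n) * r n = (r n - 1) * real (Suc n)) sequentially"
    using eventually_ge_at_top[of 1] order_tendstoD(2)[OF eps_lim zero_less_one]
    by eventually_elim (simp add: r_eq field_simps)
  ultimately have excess: "(\<lambda>n. (r n - 1) * real (Suc n)) \<longlonglongrightarrow> 0" by (simp add: tendsto_cong)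
  have "(\<lambda>n. K * ((r n - 1) * real (Suc n))) \<longlonglongrightarrow> K * 0"
    by (intro tendsto_intros excess)
  then have "eventually (\<lambda>n. K * ((r n - 1) * real (Suc n)) < 1 / 2) sequentially"
    by (rule order_tendstoD) simp
  moreover have "eventually (\<lambda>n. r n < 2) sequentially"
    by (rule order_tendstoD[OF r_lim]) simp
  ultimately have bounds: "eventually (\<lambda>n. 1 \<le> n \<and> (real (Suc n) - r n) * p n \<le> r2 n / 2 \<and>
      r2 n / 2 \<le> real (Suc n) * p n + (r n - 1) * real (Suc n) + r3 n / 6 / real (Suc n) + K * r3 n / 3 * p n \<and>
      0 < p n \<and> p n \<le> 1 \<and> 1 < r n) sequentially"
    using eventually_ge_at_top[of 1]
  proof eventually_elim
    case (elim n)
    interpret GI_M_1 "A n" "lam n" "mu n" using elim by (intro queue)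
    have "lam n / mu n < 1" using load[of n] eps_pos[of n] elim by simp
    then have less: "lam n < mu n" using mu_pos by (simp only: divide_less_eq_1_pos)
    have K: "exp (rho_moment (A n) (mu n) 1) \<le> K" using elim by (simp add: K_def r_def)
    have small: "K * (rho_moment (A n) (mu n) 1 - 1) * real (Suc n) \<le> 1 / 2"
      using elim by (simp add: r_def mult.assoc)
    have "1 < r n" using less lam_pos unfolding r_def rho_moment_1 by simp
    with loss_prob_bounds[OF less _ third_moment K small] elim show ?case
      unfolding p_def r_def r2_def r3_def by blast
  qed
  \<comment> \<open>The first bound reads \<open>n * p n - (r n - 1) * p n \<le> r2 n / 2\<close>,
    and \<open>p n \<le> 1\<close>.\<close>
  let ?U = "\<lambda>n. r2 n / 2 + (r n - 1)"
  have upper: "eventually (\<lambda>n. real n * p n \<le> ?U n) sequentially"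
    using bounds
  proof eventually_elim
    case (elim n)
    then have "(r n - 1) * p n \<le> (r n - 1) * 1" by (intro mult_left_mono) auto
    with elim show ?case by (simp add: algebra_simps)
  qed
  have "(\<lambda>n. r2 n / 2 + (r n - 1)) \<longlonglongrightarrow> rho2_lim / 2 + (1 - 1)"
    using rho2_lim unfolding r2_def by (intro tendsto_intros r_lim) auto
  then have U_lim: "?U \<longlonglongrightarrow> rho2_lim / 2" by simp
  \<comment> \<open>The upper bound alone gives \<open>p n \<rightarrow> 0\<close>, which removes
    the terms with \<open>p n\<close> from the lower bound.\<close>
  have p_lim: "p \<longlonglongrightarrow> 0"
  proof (rule tendsto_sandwich)
    show "eventually (\<lambda>n. 0 \<le> p n) sequentially"
      using bounds by eventually_elim auto
    show "eventually (\<lambda>n. p n \<le> ?U n * (1 / real n)) sequentially"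
      using upper eventually_ge_at_top[of 1] by eventually_elim (simp add: field_simps)
    show "(\<lambda>n. ?U n * (1 / real n)) \<longlonglongrightarrow> 0"
      using tendsto_mult[OF U_lim lim_1_over_n] by simp
  qed simp
  \<comment> \<open>The second bound solved for \<open>n * p n\<close>, with \<open>r3 n\<close>
    replaced by its bound \<open>B\<close>.\<close>
  let ?L = "\<lambda>n. r2 n / 2 - p n - (r n - 1) * real (Suc n) - B / 6 * (1 / real (Suc n)) - K * B / 3 * p n"
  have lower: "eventually (\<lambda>n. ?L n \<le> real n * p n) sequentially"
    using bounds
  proof eventually_elim
    case (elim n)
    have r3: "r3 n \<le> B" using B[of n] by simp
    then have "r3 n / 6 / real (Suc n) \<le> B / 6 * (1 / real (Suc n))" by (simp add: divide_right_mono)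
    moreover have "K * r3 n / 3 * p n \<le> K * B / 3 * p n"
      using r3 elim by (intro mult_right_mono divide_right_mono mult_left_mono) (auto simp: K_def)
    ultimately have "r2 n / 2 \<le> real (Suc n) * p n + (r n - 1) * real (Suc n)
        + B / 6 * (1 / real (Suc n)) + K * B / 3 * p n"
      using elim by linarith
    moreover have "real (Suc n) * p n = real n * p n + p n" by (simp add: algebra_simps)
    ultimately show ?case by linarith
  qed
  have "(\<lambda>n. 1 / real (Suc n)) \<longlonglongrightarrow> 0"
    using LIMSEQ_Suc[OF lim_1_over_n[where 'a=real]] by simp
  then have "?L \<longlonglongrightarrow> rho2_lim / 2 - 0 - 0 - B / 6 * 0 - K * B / 3 * 0"
    using rho2_lim unfolding r2_def by (intro tendsto_intros p_lim excess) auto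
  then have "?L \<longlonglongrightarrow> rho2_lim / 2" by simp
  then have "(\<lambda>n. real n * p n) \<longlonglongrightarrow> rho2_lim / 2"
    by (rule tendsto_sandwich[OF lower upper _ U_lim])
  then have lim: "(\<lambda>n. real n * p n - rho2_lim / 2) \<longlonglongrightarrow> 0"
    by (simp add: LIM_zero)
  have "eventually (\<lambda>n. real n * p n - rho2_lim / 2
      = (p n - rho2_lim / (2 * real n)) / (1 / real n)) sequentially"
    using eventually_ge_at_top[of 1] by eventually_elim (simp add: field_simps)
  from Lim_transform_eventually[OF lim this]
  show ?thesis unfolding p_def[symmetric]
    by (rule smalloI_tendsto) (use eventually_ge_at_top[of 1] in \<open>eventually_elim, simp\<close>)
qed

end
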